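(* Let $k$ be a field of characteristic $0$ and let $n$ be a positive integer. Let $\{d_1,\dots,d_n\}$ be a set of $n$ distinct positive integers with the following property: if $d_i+d_j=d_p+d_q$ for (not necessarily distinct) indices $i,j,p,q\in\{1,\dots,n\}$, then $\{d_i,d_j\}=\{d_p,d_q\}$. For each $i\in\{1,\dots,n\}$ let $f_{d_i},g_{d_i}\in k[x,y]$ be homogeneous polynomials of degree $d_i$ (each allowed to be zero), at least one of which is nonzero. Put $f=\sum_{i=1}^n f_{d_i}$, $g=\sum_{i=1}^n g_{d_i}$ and $$J=\frac{\partial f}{\partial x}\frac{\partial g}{\partial y}-\frac{\partial f}{\partial y}\frac{\partial g}{\partial x}.$$ If $J\in k\setminus\{0\}$, then $k[x,y]=k[f,g]$.
   Context: Here $k[f,g]$ denotes the $k$-subalgebra of $k[x,y]$ generated by $f$ and $g$. The condition $J\in k\setminus\{0\}$ means that $J$ is a nonzero constant polynomial. *)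

theory Defs
  imports "HOL-Computational_Algebra.Polynomial"
begin

text \<open>
  The ring k[x,y] is represented as k[x][y], that is, by the type of polynomials in y whose
  coefficients are polynomials in x: the coefficient of the monomial x^i y^j in p is
  coeff (coeff p j) i, and a constant c of k is the polynomial [:[:c:]:].
\<close>

definition partial_x :: "'a::idom poly poly \<Rightarrow> 'a poly poly" where
  "partial_x p = map_poly pderiv p"

definition partial_y :: "'a::idom poly poly \<Rightarrow> 'a poly poly" where
  "partial_y p = pderiv p"

lemma coeff_partial_x:
  "coeff (coeff (partial_x p) j) i = of_nat (Suc i) * coeff (coeff p j) (Suc i)"
  by (simp add: partial_x_def coeff_map_poly coeff_pderiv)

lemma coeff_partial_y:
  "coeff (coeff (partial_y p) j) i = of_nat (Suc j) * coeff (coeff p (Suc j)) i"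
  by (simp add: partial_y_def coeff_pderiv of_nat_poly flip: of_nat_Suc)

definition jacobian :: "'a::idom poly poly \<Rightarrow> 'a poly poly \<Rightarrow> 'a poly poly" where
  "jacobian f g = partial_x f * partial_y g - partial_y f * partial_x g"

text \<open>The zero polynomial counts as homogeneous of every degree.\<close>

definition homogeneous :: "nat \<Rightarrow> 'a::zero poly poly \<Rightarrow> bool" where
  "homogeneous d p \<longleftrightarrow> (\<forall>i j. coeff (coeff p j) i \<noteq> 0 \<longrightarrow> i + j = d)"

text \<open>Closure under scalar multiplication and negation follows, since k is contained in A.\<close>

definition subalgebra :: "'a::field poly poly set \<Rightarrow> bool" where
  "subalgebra A \<longleftrightarrow>
     (\<forall>c. [:[:c:]:] \<in> A) \<and>
     (\<forall>p\<in>A. \<forall>q\<in>A. p + q \<in> A) \<and>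
     (\<forall>p\<in>A. \<forall>q\<in>A. p * q \<in> A)"

definition generated_subalgebra :: "'a::field poly poly \<Rightarrow> 'a poly poly \<Rightarrow> 'a poly poly set" where
  "generated_subalgebra f g = subalgebra hull {f, g}"

end

theory Submission
  imports Defs
begin

text \<open>
  The Sidon condition on the degrees splits the equation J = c into
  [F 1, G 1] = c, [F m, G m] = 0 and [F m, G l] + [F l, G m] = 0 for distinct m, l, where [,] is
  the Jacobian. Two forms of equal positive degree with vanishing Jacobian are proportional, so
  (F m, G m) = (u H, v H) for some form H; the equation for the pair (1, m) then says that H has
  vanishing Jacobian with the linear form v (F 1) - u (G 1), hence is a multiple of a power of it.
  The equations for the remaining pairs force all directions (u, v) to agree. So
  f = F 1 + u P(L) and g = G 1 + v P(L) with L = v (F 1) - u (G 1) = v f - u g, and f, g generate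
  L, hence F 1 and G 1, hence x and y.
\<close>

section \<open>Notation for constants and variables in k[x,y]\<close>

abbreviation (input) const :: "'a::idom \<Rightarrow> 'a poly poly" where
  "const c \<equiv> [:[:c:]:]"

abbreviation (input) X :: "'a::idom poly poly" where
  "X \<equiv> [:[:0, 1:]:]"

abbreviation (input) Y :: "'a::idom poly poly" where
  "Y \<equiv> [:0, 1:]"

lemma coeff_coeff_const_mult: "coeff (coeff (const c * p) j) i = c * coeff (coeff p j) i"
  by simp

lemma const_1: "const 1 = 1"
  by (simp add: one_pCons)

lemma const_uminus: "const (- c) = - const c"
  by simp

lemma const_diff: "const (a - b) = const a - const b"
  by simp

lemma const_mult: "const (a * b) = const a * const b"
  by simp

lemma poly_poly_eqI:
  assumes "\<And>i j. coeff (coeff p j) i = coeff (coeff q j) i"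
  shows "p = q"
  using assms by (intro poly_eqI) auto

subsection \<open>Partial derivatives and the Jacobian\<close>

lemma partial_x_add: "partial_x (p + q) = partial_x p + partial_x q"
  by (intro poly_poly_eqI) (simp add: coeff_partial_x algebra_simps)

lemma pderiv_sum: "pderiv (\<Sum>i\<in>I. p i) = (\<Sum>i\<in>I. pderiv (p i))"
  by (induction I rule: infinite_finite_induct) (simp_all add: pderiv_add)

lemma partial_x_mult: "partial_x (p * q) = partial_x p * q + p * partial_x q"
  by (intro poly_eqI)
    (simp add: partial_x_def coeff_map_poly coeff_mult pderiv_sum pderiv_mult sum.distrib,
      simp add: algebra_simps)

lemma partial_y_add: "partial_y (p + q) = partial_y p + partial_y q"
  by (simp add: partial_y_def pderiv_add)

lemma partial_y_mult: "partial_y (p * q) = partial_y p * q + p * partial_y q"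
  by (simp add: partial_y_def pderiv_mult algebra_simps)

lemma partial_x_const: "partial_x (const c) = 0"
  by (intro poly_poly_eqI) (auto simp: coeff_partial_x coeff_pCons split: nat.splits)

lemma partial_y_const: "partial_y (const c) = 0"
  by (simp add: partial_y_def pderiv_pCons)

lemma jacobian_add_left: "jacobian (p + q) r = jacobian p r + jacobian q r"
  by (simp add: jacobian_def partial_x_add partial_y_add algebra_simps)

lemma jacobian_add_right: "jacobian p (q + r) = jacobian p q + jacobian p r"
  by (simp add: jacobian_def partial_x_add partial_y_add algebra_simps)

lemma jacobian_mult_left: "jacobian (p * q) r = p * jacobian q r + q * jacobian p r"
  unfolding jacobian_def partial_x_mult partial_y_mult by algebra

lemma jacobian_self: "jacobian p p = 0"
  by (simp add: jacobian_def)

lemma jacobian_swap: "jacobian p q = - jacobian q p"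
  unfolding jacobian_def by algebra

lemma jacobian_const_left: "jacobian (const c) p = 0"
  unfolding jacobian_def partial_x_const partial_y_const by simp

lemma jacobian_scale_left: "jacobian (const c * p) q = const c * jacobian p q"
  unfolding jacobian_mult_left jacobian_const_left by simp

lemma jacobian_scale_right: "jacobian p (const c * q) = const c * jacobian p q"
  by (subst (1 2) jacobian_swap) (simp only: jacobian_scale_left mult_minus_right)

text \<open>The chain rule for powers, stated at \<open>Suc m\<close> so that the exponent on the
  right involves no truncated subtraction.\<close>

lemma jacobian_power_left:
  "jacobian (p ^ Suc m) q = of_nat (Suc m) * p ^ m * jacobian p q"
proof (induction m)
  case (Suc m)
  have "jacobian (p ^ Suc (Suc m)) q = p * jacobian (p ^ Suc m) q + p ^ Suc m * jacobian p q"
    by (simp only: power_Suc[of p "Suc m"] jacobian_mult_left)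
  then show ?case
    unfolding Suc by (simp add: algebra_simps)
qed simp

lemma jacobian_0_left: "jacobian 0 q = 0"
  using jacobian_const_left[of 0] by simp

lemma jacobian_0_right: "jacobian p 0 = 0"
  using jacobian_swap jacobian_0_left by (metis neg_equal_0_iff_equal)

text \<open>Indexing by pairs prepares for regrouping the terms by the sum of the two
  degrees.\<close>

lemma jacobian_sum:
  "jacobian (\<Sum>a\<in>A. p a) (\<Sum>b\<in>B. q b) = (\<Sum>(a, b)\<in>A \<times> B. jacobian (p a) (q b))"
proof -
  have left: "jacobian (\<Sum>a\<in>A. p a) r = (\<Sum>a\<in>A. jacobian (p a) r)" for r
    by (induction A rule: infinite_finite_induct) (auto simp: jacobian_add_left jacobian_0_left)
  have right: "jacobian r (\<Sum>b\<in>B. q b) = (\<Sum>b\<in>B. jacobian r (q b))" for r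
    by (induction B rule: infinite_finite_induct) (auto simp: jacobian_add_right jacobian_0_right)
  show ?thesis
    by (simp only: left) (simp only: right sum.cartesian_product)
qed

subsection \<open>Homogeneous polynomials\<close>

lemma homogeneousD: "homogeneous d p \<Longrightarrow> i + j \<noteq> d \<Longrightarrow> coeff (coeff p j) i = 0"
  by (auto simp: homogeneous_def)

lemma homogeneous_diff: "homogeneous d p \<Longrightarrow> homogeneous d q \<Longrightarrow> homogeneous d (p - q)"
  unfolding homogeneous_def by (metis coeff_diff diff_zero)

lemma homogeneous_scale: "homogeneous d p \<Longrightarrow> homogeneous d (const c * p)"
  unfolding homogeneous_def coeff_coeff_const_mult by auto

lemma homogeneous_sum: "(\<And>a. a \<in> A \<Longrightarrow> homogeneous d (p a)) \<Longrightarrow> homogeneous d (\<Sum>a\<in>A. p a)"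
  unfolding homogeneous_def coeff_sum by (meson sum.neutral)

lemma homogeneous_mult:
  fixes p q :: "'a::idom poly poly"
  assumes "homogeneous d p" "homogeneous e q"
  shows "homogeneous (d + e) (p * q)"
  unfolding homogeneous_def
proof (intro allI impI)
  fix i j
  assume nz: "coeff (coeff (p * q) j) i \<noteq> 0"
  have "coeff (coeff (p * q) j) i =
      (\<Sum>k\<le>j. \<Sum>l\<le>i. coeff (coeff p k) l * coeff (coeff q (j - k)) (i - l))"
    by (simp add: coeff_mult coeff_sum)
  then obtain k l where kl: "k \<le> j" "l \<le> i"
      "coeff (coeff p k) l * coeff (coeff q (j - k)) (i - l) \<noteq> 0"
    using nz by (metis (no_types, lifting) atMost_iff sum.neutral)
  then have "l + k = d" "(i - l) + (j - k) = e"
    using assms unfolding homogeneous_def by auto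
  then show "i + j = d + e"
    using kl by simp
qed

lemma homogeneous_power:
  fixes p :: "'a::idom poly poly"
  assumes "homogeneous d p"
  shows "homogeneous (m * d) (p ^ m)"
proof (induction m)
  case 0
  show ?case
    by (auto simp: homogeneous_def coeff_1)
qed (use homogeneous_mult[OF assms] in auto)

text \<open>For \<open>d = 0\<close> the derivative vanishes, so the truncated value of
  \<open>d - 1\<close> does no harm.\<close>

lemma homogeneous_partial_x: "homogeneous d p \<Longrightarrow> homogeneous (d - 1) (partial_x p)"
  by (force simp: homogeneous_def coeff_partial_x)

lemma homogeneous_partial_y: "homogeneous d p \<Longrightarrow> homogeneous (d - 1) (partial_y p)"
  by (force simp: homogeneous_def coeff_partial_y)

lemma homogeneous_jacobian:
  assumes "homogeneous d p" "homogeneous e q" "d > 0" "e > 0"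
  shows "homogeneous (d + e - 2) (jacobian p q)"
proof -
  \<comment> \<open>Positivity of both degrees is what makes this correct for truncated
    subtraction.\<close>
  have "d - 1 + (e - 1) = d + e - 2"
    using assms by simp
  with assms show ?thesis
    unfolding jacobian_def
    by (metis homogeneous_diff homogeneous_mult homogeneous_partial_x homogeneous_partial_y)
qed

lemma homogeneous_0_const:
  assumes "homogeneous 0 p"
  obtains c where "p = const c"
proof
  show "p = const (coeff (coeff p 0) 0)"
    by (intro poly_poly_eqI) (use assms in \<open>auto simp: coeff_pCons homogeneous_def split: nat.splits\<close>)
qed

section \<open>Euler's identity and forms with vanishing Jacobian\<close>

lemma euler_homogeneous:
  assumes "homogeneous d p"
  shows "X * partial_x p + Y * partial_y p = of_nat d * p"
proof (rule poly_poly_eqI)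
  fix i j
  have x: "coeff (coeff (X * partial_x p) j) i = of_nat i * coeff (coeff p j) i"
    by (cases i) (simp_all add: coeff_partial_x)
  have y: "coeff (coeff (Y * partial_y p) j) i = of_nat j * coeff (coeff p j) i"
    by (cases j) (simp_all add: coeff_partial_y)
  have d: "coeff (coeff (of_nat d * p) j) i = of_nat d * coeff (coeff p j) i"
    by (simp add: of_nat_poly)
  have "of_nat i * coeff (coeff p j) i + of_nat j * coeff (coeff p j) i
      = of_nat d * coeff (coeff p j) i"
  proof (cases "coeff (coeff p j) i = 0")
    case False
    then have "d = i + j"
      using assms by (metis homogeneousD)
    then show ?thesis
      by (simp add: distrib_right)
  qed simp
  then show "coeff (coeff (X * partial_x p + Y * partial_y p) j) i = coeff (coeff (of_nat d * p) j) i"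
    unfolding coeff_add x y d .
qed

text \<open>Comparing leading coefficients turns the vanishing Wronskian into an equality of the two
  degrees as scalars; characteristic 0 makes it one of natural numbers.\<close>

lemma wronskian_0_degree_eq:
  fixes p q :: "'a::{idom, ring_char_0} poly"
  assumes "pderiv p * q = p * pderiv q" "p \<noteq> 0" "q \<noteq> 0"
  shows "degree p = degree q"
proof -
  \<comment> \<open>This also covers constant \<open>r\<close>, where both sides are 0.\<close>
  have lc: "lead_coeff (pderiv r) = of_nat (degree r) * lead_coeff r" for r :: "'a poly"
    by (cases "degree r") (auto simp: degree_pderiv coeff_pderiv coeff_eq_0)
  have "of_nat (degree p) * lead_coeff p * lead_coeff q
      = lead_coeff p * (of_nat (degree q) * lead_coeff q)"
    using arg_cong[OF assms(1), of lead_coeff] by (simp only: lead_coeff_mult lc)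
  then show ?thesis
    using assms by simp
qed

text \<open>Subtracting the right multiple of \<open>q\<close> from \<open>p\<close> leaves a form
  \<open>r\<close> whose coefficient at the y-degree of \<open>q\<close> is 0. By Euler's identity
  the Wronskian of \<open>r\<close> and \<open>q\<close> in y vanishes, so a nonzero
  \<open>r\<close> would have the same y-degree as \<open>q\<close>.\<close>

lemma homogeneous_jacobian_0_proportional:
  fixes p q :: "'k::field_char_0 poly poly"
  assumes p: "homogeneous d p" and q: "homogeneous d q" and "d > 0" "q \<noteq> 0"
    and jac: "jacobian p q = 0"
  obtains c where "p = const c * q"
proof -
  define m where "m = degree q"
  have lead: "coeff q m \<noteq> 0"
    using \<open>q \<noteq> 0\<close> by (simp add: m_def)
  \<comment> \<open>In a form of degree \<open>d\<close> the coefficient of \<open>y^m\<close> is a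
    multiple of \<open>x^(d - m)\<close>, so \<open>a\<close> and \<open>b\<close> determine
    \<open>coeff p m\<close> and \<open>coeff q m\<close> completely.\<close>
  define a b where "a = coeff (coeff p m) (d - m)" and "b = coeff (coeff q m) (d - m)"
  have "b \<noteq> 0"
  proof -
    obtain i where "coeff (coeff q m) i \<noteq> 0"
      using lead by (metis poly_eqI coeff_0)
    then show ?thesis
      using q unfolding homogeneous_def b_def by (metis diff_add_inverse2)
  qed
  define r where "r = p - const (a / b) * q"
  have r: "homogeneous d r"
    unfolding r_def by (intro homogeneous_diff homogeneous_scale p q)
  have "jacobian r q = jacobian p q - const (a / b) * jacobian q q"
    using jacobian_add_left[of r "const (a / b) * q" q]
    unfolding jacobian_scale_left r_def by simp
  then have jac_r: "jacobian r q = 0"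
    by (simp add: jac jacobian_self)
  \<comment> \<open>Euler's identity replaces \<open>d * q\<close> and \<open>d * r\<close>; the
    terms with \<open>Y\<close> cancel and only a multiple of the Jacobian remains.\<close>
  have "of_nat d * (partial_y r * q - r * partial_y q)
      = partial_y r * (X * partial_x q + Y * partial_y q)
        - (X * partial_x r + Y * partial_y r) * partial_y q"
    unfolding euler_homogeneous[OF r] euler_homogeneous[OF q] by algebra
  also have "\<dots> = - X * jacobian r q"
    unfolding jacobian_def by algebra
  finally have wronskian: "pderiv r * q = r * pderiv q"
    using jac_r \<open>d > 0\<close> by (simp add: partial_y_def)
  have "coeff (coeff r m) i = 0" for i
  proof (cases "i = d - m")
    case True
    then show ?thesis
      using \<open>b \<noteq> 0\<close> by (simp add: r_def a_def b_def)
  next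
    case False
    then have "i + m \<noteq> d"
      by auto
    then show ?thesis
      using homogeneousD[OF r] by blast
  qed
  then have "coeff r m = 0"
    by (intro poly_eqI) simp
  \<comment> \<open>A nonzero \<open>r\<close> would have y-degree \<open>m\<close>, hence a nonzero
    coefficient there.\<close>
  then have "r = 0"
    using wronskian_0_degree_eq[OF wronskian _ \<open>q \<noteq> 0\<close>] m_def by (metis leading_coeff_0_iff)
  then show thesis
    using that by (simp add: r_def)
qed

text \<open>By the power rule \<open>l ^ d\<close> also has vanishing Jacobian with
  \<open>p\<close>, and it is a nonzero form of the same degree, so proportionality applies.\<close>

lemma homogeneous_jacobian_0_linear:
  fixes l p :: "'k::field_char_0 poly poly"
  assumes "homogeneous 1 l" "homogeneous d p" "d > 0" "l \<noteq> 0" "jacobian l p = 0"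
  obtains c where "p = const c * l ^ d"
proof -
  obtain m where "d = Suc m"
    using \<open>d > 0\<close> gr0_conv_Suc by blast
  then have "jacobian (l ^ d) p = 0"
    using assms by (simp only: jacobian_power_left) simp
  then have "jacobian p (l ^ d) = 0"
    by (subst jacobian_swap) simp
  moreover have "homogeneous d (l ^ d)"
    using homogeneous_power[OF assms(1), of d] by simp
  ultimately show thesis
    using homogeneous_jacobian_0_proportional[of d p "l ^ d"] assms that by auto
qed

subsection \<open>Subalgebras\<close>

context
  fixes A :: "'k::field poly poly set"
  assumes A: "subalgebra A"
begin

lemma subalgebra_const: "const c \<in> A"
  and subalgebra_add: "p \<in> A \<Longrightarrow> q \<in> A \<Longrightarrow> p + q \<in> A"
  and subalgebra_mult: "p \<in> A \<Longrightarrow> q \<in> A \<Longrightarrow> p * q \<in> A"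
  using A by (auto simp: subalgebra_def)

lemma subalgebra_diff: "p \<in> A \<Longrightarrow> q \<in> A \<Longrightarrow> p - q \<in> A"
  using subalgebra_add[OF _ subalgebra_mult[OF subalgebra_const[of "- 1"]], of p q]
  unfolding const_uminus const_1 by simp

lemma subalgebra_power: "p \<in> A \<Longrightarrow> p ^ m \<in> A"
  by (induction m) (use subalgebra_const[of 1] in \<open>auto intro: subalgebra_mult simp: one_pCons\<close>)

lemma subalgebra_sum: "(\<And>i. i \<in> I \<Longrightarrow> p i \<in> A) \<Longrightarrow> (\<Sum>i\<in>I. p i) \<in> A"
  by (induction I rule: infinite_finite_induct)
    (use subalgebra_const[of 0] in \<open>auto intro: subalgebra_add\<close>)

lemma subalgebra_eq_UNIV:
  assumes "X \<in> A" "Y \<in> A"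
  shows "A = UNIV"
proof -
  have coeffs: "[:a:] \<in> A" for a
  proof (induction a)
    case 0
    show ?case
      using subalgebra_const[of 0] by simp
  next
    case (pCons c a)
    have "[:pCons c a:] = const c + X * [:a:]"
      by simp
    with pCons show ?case
      using assms subalgebra_add subalgebra_mult subalgebra_const by metis
  qed
  have "p \<in> A" for p
  proof (induction p)
    case 0
    show ?case
      using coeffs[of 0] by simp
  next
    case (pCons a p)
    have "pCons a p = [:a:] + Y * p"
      by simp
    with pCons show ?case
      using assms subalgebra_add subalgebra_mult coeffs by metis
  qed
  then show ?thesis
    by blast
qed

text \<open>The partial derivatives of linear forms are constants, so Euler's identity writes
  \<open>p\<close> and \<open>q\<close> as a linear system in \<open>X\<close> and \<open>Y\<close>
  with determinant \<open>c\<close>. Cramer's rule recovers both variables inside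
  \<open>A\<close>.\<close>

lemma subalgebra_eq_UNIV_linear:
  fixes p q :: "'k poly poly"
  assumes p: "homogeneous 1 p" and q: "homogeneous 1 q" and "p \<in> A" "q \<in> A"
    and jac: "jacobian p q = const c" and "c \<noteq> 0"
  shows "A = UNIV"
proof -
  have deg0: "homogeneous 0 (partial_x r) \<and> homogeneous 0 (partial_y r)"
    if "homogeneous 1 r" for r :: "'k poly poly"
    using homogeneous_partial_x[OF that] homogeneous_partial_y[OF that] by simp
  have px: "\<exists>c. partial_x r = const c" and py: "\<exists>c. partial_y r = const c"
    if "homogeneous 1 r" for r :: "'k poly poly"
    using deg0[OF that] homogeneous_0_const by metis+
  have partials: "partial_x r \<in> A" "partial_y r \<in> A"
    if "homogeneous 1 r" for r
    using px[OF that] py[OF that] subalgebra_const by auto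
  have inv: "const (1 / c) * (const c * r) = r" for r
    using \<open>c \<noteq> 0\<close> by (simp add: one_pCons[symmetric])
  have "const c * X = partial_y q * (X * partial_x p + Y * partial_y p)
      - partial_y p * (X * partial_x q + Y * partial_y q)"
    unfolding jac[symmetric] jacobian_def by algebra
  then have "const c * X = partial_y q * p - partial_y p * q"
    unfolding euler_homogeneous[OF p] euler_homogeneous[OF q] by simp
  then have "const c * X \<in> A"
    using subalgebra_diff subalgebra_mult partials p q assms(3,4) by metis
  then have "X \<in> A"
    using subalgebra_mult[OF subalgebra_const[of "1 / c"]] inv[of X] by metis
  moreover
  have "const c * Y = partial_x p * (X * partial_x q + Y * partial_y q)
      - partial_x q * (X * partial_x p + Y * partial_y p)"
    unfolding jac[symmetric] jacobian_def by algebra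
  then have "const c * Y = partial_x p * q - partial_x q * p"
    unfolding euler_homogeneous[OF p] euler_homogeneous[OF q] by simp
  then have "const c * Y \<in> A"
    using subalgebra_diff subalgebra_mult partials p q assms(3,4) by metis
  then have "Y \<in> A"
    using subalgebra_mult[OF subalgebra_const[of "1 / c"]] inv[of Y] by metis
  ultimately show ?thesis
    by (rule subalgebra_eq_UNIV)
qed

end

text \<open>The hull is an intersection, so it suffices to argue inside an arbitrary subalgebra
  containing \<open>f\<close> and \<open>g\<close>.\<close>

lemma generated_subalgebra_eq_UNIV:
  assumes "\<And>A. subalgebra A \<Longrightarrow> f \<in> A \<Longrightarrow> g \<in> A \<Longrightarrow> A = UNIV"
  shows "generated_subalgebra f g = UNIV"
  unfolding generated_subalgebra_def hull_def using assms by auto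

subsection \<open>Splitting the Jacobian condition\<close>

text \<open>The bracket of forms of degrees \<open>l\<close> and \<open>m\<close> has degree
  \<open>l + m - 2\<close>, so the pairs with sum \<open>s\<close> make up the homogeneous part of
  degree \<open>s - 2\<close> of the whole Jacobian.\<close>

lemma jacobian_component:
  fixes F G :: "nat \<Rightarrow> 'k::field poly poly"
  assumes "finite D"
    and pos: "\<And>m. m \<in> D \<Longrightarrow> m > 0"
    and F: "\<And>m. m \<in> D \<Longrightarrow> homogeneous m (F m)"
    and G: "\<And>m. m \<in> D \<Longrightarrow> homogeneous m (G m)"
    and J: "jacobian (\<Sum>m\<in>D. F m) (\<Sum>m\<in>D. G m) = const c"
    and "s \<ge> 2"
  shows "(\<Sum>(l, m)\<in>{(l, m)\<in>D \<times> D. l + m = s}. jacobian (F l) (G m)) =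
    (if s = 2 then const c else 0)" (is "sum ?t ?S = _")
proof (rule poly_poly_eqI)
  fix i j
  have hom: "homogeneous (l + m - 2) (jacobian (F l) (G m))" if "l \<in> D" "m \<in> D" for l m
    using homogeneous_jacobian F G pos that by blast
  have "homogeneous (s - 2) (sum ?t ?S)"
    by (intro homogeneous_sum) (use hom in auto)
  moreover have "coeff (coeff (sum ?t ?S) j) i = coeff (coeff (const c) j) i" if "i + j = s - 2"
  proof -
    have "coeff (coeff (?t z) j) i = 0" if z: "z \<in> D \<times> D - ?S" for z
    proof -
      obtain l m where lm: "z = (l, m)" "l \<in> D" "m \<in> D" "l + m \<noteq> s"
        using z by auto
      \<comment> \<open>Since \<open>l + m\<close> and \<open>s\<close> are both at least 2,
        truncated subtraction of 2 keeps different sums apart.\<close>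
      then have "i + j \<noteq> l + m - 2"
        using \<open>i + j = s - 2\<close> \<open>s \<ge> 2\<close> pos[of l] pos[of m] by linarith
      then show ?thesis
        using homogeneousD[OF hom] lm by simp
    qed
    then have "coeff (coeff (sum ?t ?S) j) i = coeff (coeff (sum ?t (D \<times> D)) j) i"
      unfolding coeff_sum using \<open>finite D\<close> by (intro sum.mono_neutral_left) auto
    then show ?thesis
      using J by (simp add: jacobian_sum)
  qed
  ultimately show "coeff (coeff (sum ?t ?S) j) i
      = coeff (coeff (if s = 2 then const c else 0) j) i"
    using \<open>s \<ge> 2\<close> by (cases "i + j = s - 2")
      (auto simp: homogeneousD coeff_pCons split: nat.splits)
qed

text \<open>The Sidon condition leaves only \<open>(l, m)\<close> and \<open>(m, l)\<close> with sum
  \<open>l + m\<close>, so each homogeneous component collapses to one bracket (for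
  \<open>l = m\<close>) or two.\<close>

lemma sidon_jacobian_components:
  fixes F G :: "nat \<Rightarrow> 'k::field poly poly"
  assumes "finite D"
    and pos: "\<And>m. m \<in> D \<Longrightarrow> m > 0"
    and sidon: "\<And>i j p q. \<lbrakk>i \<in> D; j \<in> D; p \<in> D; q \<in> D; i + j = p + q\<rbrakk> \<Longrightarrow> {i, j} = {p, q}"
    and F: "\<And>m. m \<in> D \<Longrightarrow> homogeneous m (F m)"
    and G: "\<And>m. m \<in> D \<Longrightarrow> homogeneous m (G m)"
    and J: "jacobian (\<Sum>m\<in>D. F m) (\<Sum>m\<in>D. G m) = const c"
    and "c \<noteq> 0"
  shows "1 \<in> D"
    and "jacobian (F 1) (G 1) = const c"
    and "\<And>m. m \<in> D \<Longrightarrow> m \<noteq> 1 \<Longrightarrow> jacobian (F m) (G m) = 0"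
    and "\<And>l m. l \<in> D \<Longrightarrow> m \<in> D \<Longrightarrow> l \<noteq> m \<Longrightarrow> jacobian (F l) (G m) + jacobian (F m) (G l) = 0"
proof -
  have comp: "(\<Sum>(a, b)\<in>{(a, b)\<in>D \<times> D. a + b = s}. jacobian (F a) (G b)) =
      (if s = 2 then const c else 0)" if "s \<ge> 2" for s
    by (rule jacobian_component[OF \<open>finite D\<close> pos F G J that])
  have set: "{(a, b)\<in>D \<times> D. a + b = l + m} = {(l, m), (m, l)}" if "l \<in> D" "m \<in> D" for l m
  proof -
    have "(a, b) = (l, m) \<or> (a, b) = (m, l)" if "a \<in> D" "b \<in> D" "a + b = l + m" for a b
      using sidon[OF that(1,2) \<open>l \<in> D\<close> \<open>m \<in> D\<close> that(3)] by (auto simp: doubleton_eq_iff)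
    then show ?thesis
      using that by (auto simp: add.commute)
  qed
  have diag: "jacobian (F m) (G m) = (if m = 1 then const c else 0)" if "m \<in> D" for m
  proof -
    have "m + m \<ge> 2"
      using pos[OF that] by linarith
    then have "(\<Sum>(a, b)\<in>{(m, m)}. jacobian (F a) (G b)) = (if m + m = 2 then const c else 0)"
      using comp[of "m + m"] unfolding set[OF that that] insert_absorb2 by blast
    moreover have "m + m = 2 \<longleftrightarrow> m = 1"
      by linarith
    ultimately show ?thesis
      by simp
  qed
  show one: "1 \<in> D"
  proof (rule ccontr)
    assume "1 \<notin> D"
    \<comment> \<open>Positive degrees add up to 2 only as 1 + 1. Without 1 in \<open>D\<close> the
      component of degree 0 would be an empty sum, yet it equals the nonzero constant.\<close>
    have "a + b \<noteq> 2" if "a \<in> D" "b \<in> D" for a b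
    proof
      assume "a + b = 2"
      then have "a = 1"
        using pos[OF that(1)] pos[OF that(2)] by linarith
      with that \<open>1 \<notin> D\<close> show False
        by blast
    qed
    then have "{(a, b)\<in>D \<times> D. a + b = 2} = {}"
      by blast
    then have "const c = 0"
      using comp[of 2] by (simp only: sum.empty) simp
    with \<open>c \<noteq> 0\<close> show False
      by simp
  qed
  show "jacobian (F 1) (G 1) = const c"
    using diag[OF one] by simp
  show "jacobian (F m) (G m) = 0" if "m \<in> D" "m \<noteq> 1" for m
    using diag that by simp
  show "jacobian (F l) (G m) + jacobian (F m) (G l) = 0" if "l \<in> D" "m \<in> D" "l \<noteq> m" for l m
  proof -
    have "l + m \<ge> 2" "l + m \<noteq> 2"
      using pos[OF that(1)] pos[OF that(2)] that(3) by linarith+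
    then have "(\<Sum>(a, b)\<in>{(l, m), (m, l)}. jacobian (F a) (G b)) = 0"
      using comp[of "l + m"] unfolding set[OF that(1,2)] by metis
    then show ?thesis
      using that(3) by simp
  qed
qed

section \<open>Directions of the pairs of forms\<close>

text \<open>The scalar factor is the determinant of the change from \<open>p\<close>,
  \<open>q\<close> to the two combinations; it vanishes exactly when \<open>(u, v)\<close> and
  \<open>(u', v')\<close> are parallel.\<close>

lemma jacobian_linear_combinations:
  "jacobian (const v * p - const u * q) (const v' * p - const u' * q)
    = const (u * v' - u' * v) * jacobian p q"
proof -
  have "jacobian (const v * p - const u * q) (const v' * p - const u' * q)
      = jacobian (const v * p + const (- u) * q) (const v' * p + const (- u') * q)"
    by (simp only: const_uminus mult_minus_left diff_conv_add_uminus)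
  also have "\<dots> = const v * const (- u') * jacobian p q
      + const (- u) * const v' * jacobian q p"
    unfolding jacobian_add_left jacobian_add_right jacobian_scale_left jacobian_scale_right
      jacobian_self by algebra
  also have "jacobian q p = - jacobian p q"
    by (rule jacobian_swap)
  finally show ?thesis
    unfolding const_uminus const_diff const_mult by algebra
qed

lemma homogeneous_linear_combination:
  "homogeneous d p \<Longrightarrow> homogeneous d q \<Longrightarrow> homogeneous d (const v * p - const u * q)"
  by (intro homogeneous_diff homogeneous_scale)

text \<open>Bracketing a vanishing combination with any other one makes the determinant 0; the two
  unit vectors as second direction isolate \<open>u\<close> and \<open>v\<close>.\<close>

lemma linear_combination_nonzero:
  assumes jac: "jacobian p q = const c" "c \<noteq> 0" and "const v * p - const u * q = 0"
  shows "u = 0" "v = 0"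
proof -
  have "const (u * v' - u' * v) * const c = 0" for u' v'
    using jacobian_linear_combinations[of v p u q v' u'] jacobian_0_left assms by metis
  from this[of 1 0] this[of 0 1] show "u = 0" "v = 0"
    using \<open>c \<noteq> 0\<close> by simp_all
qed

text \<open>Proportionality gives \<open>F = u H\<close> and \<open>G = v H\<close>. With
  \<open>L = v p - u q\<close>, bilinearity turns the mixed relation into
  \<open>jacobian L H = 0\<close>, so \<open>H\<close> is a multiple of
  \<open>L ^ m\<close>.\<close>

lemma form_pair_normal_form:
  fixes p q F G :: "'k::field_char_0 poly poly"
  assumes p: "homogeneous 1 p" and q: "homogeneous 1 q"
    and jac: "jacobian p q = const c" "c \<noteq> 0"
    and F: "homogeneous m F" and G: "homogeneous m G" and "m > 0"
    and nz: "F \<noteq> 0 \<or> G \<noteq> 0"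
    and FG: "jacobian F G = 0"
    and mixed: "jacobian p G + jacobian F q = 0"
  obtains e u v where "e \<noteq> 0" "u \<noteq> 0 \<or> v \<noteq> 0"
    and "F = const u * (const e * (const v * p - const u * q) ^ m)"
    and "G = const v * (const e * (const v * p - const u * q) ^ m)"
proof -
  obtain u v H where uv: "u \<noteq> 0 \<or> v \<noteq> 0" and H: "homogeneous m H" "H \<noteq> 0"
    and FH: "F = const u * H" and GH: "G = const v * H"
  proof (cases "G = 0")
    case True
    then show ?thesis
      using that[of 1 0 F] nz F by (simp flip: one_pCons)
  next
    case False
    then obtain a where "F = const a * G"
      using homogeneous_jacobian_0_proportional[OF F G \<open>m > 0\<close> _ FG] by blast
    then show ?thesis
      using that[of a 1 G] G False by (simp flip: one_pCons)
  qed
  define L where "L = const v * p - const u * q"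
  have "jacobian L H = jacobian (const v * p + const (- u) * q) H"
    by (simp only: L_def const_uminus mult_minus_left diff_conv_add_uminus)
  also have "\<dots> = jacobian p G + const u * (- jacobian q H)"
    unfolding jacobian_add_left jacobian_scale_left GH jacobian_scale_right
    by (simp only: const_uminus mult_minus_left mult_minus_right)
  also have "\<dots> = jacobian p G + jacobian F q"
    unfolding FH jacobian_scale_left by (simp only: jacobian_swap[of H q])
  finally have "jacobian L H = 0"
    using mixed by simp
  moreover have "homogeneous 1 L" "L \<noteq> 0"
    unfolding L_def using homogeneous_linear_combination[OF p q] linear_combination_nonzero[OF jac] uv
    by blast+
  ultimately obtain e where e: "H = const e * L ^ m"
    using homogeneous_jacobian_0_linear H \<open>m > 0\<close> by metis
  then have "e \<noteq> 0"
    using H by auto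
  then show thesis
    using that[of e u v] uv e FH GH L_def by simp
qed

text \<open>The mixed relation equals \<open>u * v' - u' * v\<close> times
  \<open>jacobian H H'\<close>. By the power rule the latter is a nonzero multiple of the bracket of
  the two linear forms, which is that same determinant times \<open>c\<close>. So the determinant
  vanishes either way.\<close>

lemma form_pairs_same_direction:
  fixes p q :: "'k::field_char_0 poly poly"
  assumes jac: "jacobian p q = const c" "c \<noteq> 0"
    and "l > 0" "m > 0" "e \<noteq> 0" "e' \<noteq> 0" "u \<noteq> 0 \<or> v \<noteq> 0" "u' \<noteq> 0 \<or> v' \<noteq> 0"
    and H: "H = const e * (const v * p - const u * q) ^ l"
    and H': "H' = const e' * (const v' * p - const u' * q) ^ m"
    and mixed: "jacobian (const u * H) (const v' * H') + jacobian (const u' * H') (const v * H) = 0"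
  shows "u * v' = u' * v"
proof -
  let ?L = "const v * p - const u * q" and ?L' = "const v' * p - const u' * q"
  obtain a b where lm: "l = Suc a" "m = Suc b"
    using assms by (metis gr0_conv_Suc)
  have nz: "?L \<noteq> 0" "?L' \<noteq> 0"
    using linear_combination_nonzero[OF jac] assms by blast+
  \<comment> \<open>The power rule in the first argument, and in the second by antisymmetry.\<close>
  have powers: "jacobian (?L ^ l) (?L' ^ m)
      = of_nat l * of_nat m * ?L ^ a * ?L' ^ b * jacobian ?L ?L'"
    unfolding lm jacobian_power_left
    by (subst (1 2) jacobian_swap) (simp only: jacobian_power_left mult_minus_right, simp add: mult_ac)
  have HH': "jacobian H H' = const e * (const e' * jacobian (?L ^ l) (?L' ^ m))"
    unfolding H H' jacobian_scale_left jacobian_scale_right by (rule mult.left_commute)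
  have "const (u * v' - u' * v) * jacobian H H'
      = jacobian (const u * H) (const v' * H') + jacobian (const u' * H') (const v * H)"
    unfolding jacobian_scale_left jacobian_scale_right jacobian_swap[of H' H]
      const_diff const_mult by algebra
  then have "const (u * v' - u' * v) * jacobian H H' = 0"
    using mixed by simp
  then have "u * v' - u' * v = 0 \<or> jacobian ?L ?L' = 0"
    unfolding HH' powers using nz assms by auto
  then show ?thesis
    unfolding jacobian_linear_combinations jac(1) using \<open>c \<noteq> 0\<close> by auto
qed

lemma parallel_vectors:
  fixes u v u' v' :: "'k::field"
  assumes "u \<noteq> 0 \<or> v \<noteq> 0" "u * v' = u' * v"
  obtains t where "u' = t * u" "v' = t * v"
proof (cases "u = 0")
  case True
  with assms show ?thesis
    using that[of "v' / v"] by simp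
next
  case False
  with assms show ?thesis
    using that[of "u' / u"] by (simp add: field_simps)
qed

text \<open>One degree \<open>l\<close> in \<open>D\<close> fixes the direction
  \<open>(u, v)\<close>. Every other direction is a multiple \<open>t\<close> of it, so its linear
  form is \<open>t\<close> times the reference form and all powers of \<open>t\<close> go into the
  coefficient \<open>a m\<close>.\<close>

lemma common_direction:
  fixes p q :: "'k::field_char_0 poly poly"
  assumes p: "homogeneous 1 p" and q: "homogeneous 1 q"
    and jac: "jacobian p q = const c" "c \<noteq> 0"
    and pos: "\<And>m. m \<in> D \<Longrightarrow> m > 0"
    and F: "\<And>m. m \<in> D \<Longrightarrow> homogeneous m (F m)"
    and G: "\<And>m. m \<in> D \<Longrightarrow> homogeneous m (G m)"
    and nz: "\<And>m. m \<in> D \<Longrightarrow> F m \<noteq> 0 \<or> G m \<noteq> 0"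
    and FG: "\<And>m. m \<in> D \<Longrightarrow> jacobian (F m) (G m) = 0"
    and pq: "\<And>m. m \<in> D \<Longrightarrow> jacobian p (G m) + jacobian (F m) q = 0"
    and mixed: "\<And>l m. l \<in> D \<Longrightarrow> m \<in> D \<Longrightarrow> l \<noteq> m \<Longrightarrow>
      jacobian (F l) (G m) + jacobian (F m) (G l) = 0"
  obtains u v a where
    "\<And>m. m \<in> D \<Longrightarrow> F m = const u * (const (a m) * (const v * p - const u * q) ^ m)"
    "\<And>m. m \<in> D \<Longrightarrow> G m = const v * (const (a m) * (const v * p - const u * q) ^ m)"
proof (cases "D = {}")
  case True
  then show ?thesis
    using that by blast
next
  case False
  then obtain l where l: "l \<in> D"
    by blast
  obtain e u v where e: "e \<noteq> 0" and uv: "u \<noteq> 0 \<or> v \<noteq> 0"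
    and Fl: "F l = const u * (const e * (const v * p - const u * q) ^ l)"
    and Gl: "G l = const v * (const e * (const v * p - const u * q) ^ l)"
    using form_pair_normal_form[OF p q jac F G pos nz FG pq] l by metis
  let ?L = "const v * p - const u * q"
  have "\<exists>a. F m = const u * (const a * ?L ^ m) \<and> G m = const v * (const a * ?L ^ m)"
    if m: "m \<in> D" for m
  proof (cases "m = l")
    case True
    then show ?thesis
      using Fl Gl by blast
  next
    case False
    obtain e' u' v' where e': "e' \<noteq> 0" and uv': "u' \<noteq> 0 \<or> v' \<noteq> 0"
      and Fm: "F m = const u' * (const e' * (const v' * p - const u' * q) ^ m)"
      and Gm: "G m = const v' * (const e' * (const v' * p - const u' * q) ^ m)"
      using form_pair_normal_form[OF p q jac F G pos nz FG pq] m by metis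
    have "u * v' = u' * v"
      using form_pairs_same_direction[OF jac pos[OF l] pos[OF m] e e' uv uv' refl refl]
        mixed[OF l m] False Fl Gl Fm Gm by metis
    then obtain t where t: "u' = t * u" "v' = t * v"
      using parallel_vectors uv by blast
    have "const v' * p - const u' * q = const t * ?L"
      by (simp add: t smult_diff_right mult.commute)
    then have "(const v' * p - const u' * q) ^ m = const (t ^ m) * ?L ^ m"
      by (simp only: power_mult_distrib) (simp add: poly_const_pow)
    \<comment> \<open>One factor \<open>t\<close> comes from \<open>u' = t * u\<close> or
      \<open>v' = t * v\<close>, and \<open>t ^ m\<close> from the power of the linear form.\<close>
    then have "F m = const u * (const (t * e' * t ^ m) * ?L ^ m)"
      "G m = const v * (const (t * e' * t ^ m) * ?L ^ m)"
      unfolding Fm Gm by (simp_all add: t mult_ac)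
    then show ?thesis
      by blast
  qed
  then obtain a where "\<And>m. m \<in> D \<Longrightarrow> F m = const u * (const (a m) * ?L ^ m)"
    "\<And>m. m \<in> D \<Longrightarrow> G m = const v * (const (a m) * ?L ^ m)"
    by metis
  then show ?thesis
    using that by blast
qed

section \<open>Generation of k[x,y] and conclusion\<close>

lemma elementary_map_generates:
  fixes p q :: "'k::field poly poly"
  assumes p: "homogeneous 1 p" and q: "homogeneous 1 q"
    and jac: "jacobian p q = const c" "c \<noteq> 0"
    and L: "L = const v * p - const u * q"
    and P: "P = (\<Sum>m\<in>D. const (a m) * L ^ m)"
  shows "generated_subalgebra (p + const u * P) (q + const v * P) = UNIV"
    (is "generated_subalgebra ?f ?g = _")
proof (rule generated_subalgebra_eq_UNIV)
  fix A assume A: "subalgebra A" and fg: "?f \<in> A" "?g \<in> A"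
  \<comment> \<open>The contributions of \<open>P\<close> cancel, so \<open>L\<close> is already a
    linear combination of the generators; \<open>P\<close> is then available as a polynomial in
    \<open>L\<close>.\<close>
  have "L = const v * ?f - const u * ?g"
    unfolding L by (simp add: smult_add_right mult.commute)
  then have "L \<in> A"
    using fg subalgebra_diff[OF A] subalgebra_mult[OF A] subalgebra_const[OF A] by metis
  then have "P \<in> A"
    unfolding P by (intro subalgebra_sum subalgebra_mult subalgebra_const subalgebra_power A)
  then have "?f - const u * P \<in> A" "?g - const v * P \<in> A"
    using subalgebra_diff[OF A] subalgebra_mult[OF A subalgebra_const[OF A]] fg by blast+
  then have "p \<in> A" "q \<in> A"
    by simp_all
  then show "A = UNIV"
    using subalgebra_eq_UNIV_linear[OF A p q _ _ jac] by blast
qed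

theorem theorem2:
  fixes n :: nat
    and d :: "nat \<Rightarrow> nat"
    and F G :: "nat \<Rightarrow> 'k::field_char_0 poly poly"
    and f g :: "'k poly poly"
  assumes n_pos: "n \<ge> 1"
    and d_pos: "\<And>i. i \<in> {1..n} \<Longrightarrow> d i > 0"
    and d_distinct: "inj_on d {1..n}"
    and d_sums: "\<And>i j p q. \<lbrakk>i \<in> {1..n}; j \<in> {1..n}; p \<in> {1..n}; q \<in> {1..n};
                   d i + d j = d p + d q\<rbrakk> \<Longrightarrow> {d i, d j} = {d p, d q}"
    and F_hom: "\<And>i. i \<in> {1..n} \<Longrightarrow> homogeneous (d i) (F (d i))"
    and G_hom: "\<And>i. i \<in> {1..n} \<Longrightarrow> homogeneous (d i) (G (d i))"
    and nonzero: "\<And>i. i \<in> {1..n} \<Longrightarrow> F (d i) \<noteq> 0 \<or> G (d i) \<noteq> 0"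
    and f_eq: "f = (\<Sum>i = 1..n. F (d i))"
    and g_eq: "g = (\<Sum>i = 1..n. G (d i))"
    and J_const: "\<exists>c::'k. c \<noteq> 0 \<and> jacobian f g = [:[:c:]:]"
  shows "(UNIV :: 'k poly poly set) = generated_subalgebra f g"
proof -
  \<comment> \<open>The argument is indexed by the degrees themselves; injectivity of
    \<open>d\<close> carries the sums over.\<close>
  define D where "D = d ` {1..n}"
  have fin: "finite D"
    by (simp add: D_def)
  have pos: "m > 0" if "m \<in> D" for m
    using d_pos that by (auto simp: D_def)
  have F: "homogeneous m (F m)" if "m \<in> D" for m
    using F_hom that by (auto simp: D_def)
  have G: "homogeneous m (G m)" if "m \<in> D" for m
    using G_hom that by (auto simp: D_def)
  have nz: "F m \<noteq> 0 \<or> G m \<noteq> 0" if "m \<in> D" for m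
    using nonzero that by (auto simp: D_def)
  have sidon: "{i, j} = {p, q}"
    if "i \<in> D" "j \<in> D" "p \<in> D" "q \<in> D" "i + j = p + q" for i j p q
  proof -
    obtain i' j' p' q' where "i = d i'" "j = d j'" "p = d p'" "q = d q'"
      "i' \<in> {1..n}" "j' \<in> {1..n}" "p' \<in> {1..n}" "q' \<in> {1..n}"
      using \<open>i \<in> D\<close> \<open>j \<in> D\<close> \<open>p \<in> D\<close> \<open>q \<in> D\<close> unfolding D_def by blast
    with d_sums[of i' j' p' q'] \<open>i + j = p + q\<close> show ?thesis
      by blast
  qed
  have f: "f = (\<Sum>m\<in>D. F m)" and g: "g = (\<Sum>m\<in>D. G m)"
    unfolding D_def f_eq g_eq sum.reindex[OF d_distinct] by simp_all
  obtain c where "c \<noteq> 0" and J: "jacobian (\<Sum>m\<in>D. F m) (\<Sum>m\<in>D. G m) = const c"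
    using J_const f g by blast
  have mixed: "jacobian (F l) (G m) + jacobian (F m) (G l) = 0"
    if "l \<in> D" "m \<in> D" "l \<noteq> m" for l m
    by (rule sidon_jacobian_components(4)[OF fin pos sidon F G J \<open>c \<noteq> 0\<close> that])
  have diag: "jacobian (F m) (G m) = 0" if "m \<in> D" "m \<noteq> 1" for m
    by (rule sidon_jacobian_components(3)[OF fin pos sidon F G J \<open>c \<noteq> 0\<close> that])
  have one: "1 \<in> D" and jac: "jacobian (F 1) (G 1) = const c"
    by (rule sidon_jacobian_components(1,2)[OF fin pos sidon F G J \<open>c \<noteq> 0\<close>]; assumption)+
  \<comment> \<open>Degree 1 is set aside: \<open>F 1\<close> and \<open>G 1\<close> act as linear
    coordinates, and the relations for the pairs \<open>(1, m)\<close> tie every other degree to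
    them.\<close>
  define E where "E = D - {1}"
  have E: "m \<in> D" "m \<noteq> 1" if "m \<in> E" for m
    using that by (auto simp: E_def)
  obtain u v a where
    FE: "\<And>m. m \<in> E \<Longrightarrow> F m = const u * (const (a m) * (const v * F 1 - const u * G 1) ^ m)" and
    GE: "\<And>m. m \<in> E \<Longrightarrow> G m = const v * (const (a m) * (const v * F 1 - const u * G 1) ^ m)"
  proof (rule common_direction[of "F 1" "G 1" c E F G])
    show "jacobian (F 1) (G m) + jacobian (F m) (G 1) = 0" if "m \<in> E" for m
      using mixed[OF one E(1)[OF that]] E(2)[OF that] by metis
    show "jacobian (F l) (G m) + jacobian (F m) (G l) = 0" if "l \<in> E" "m \<in> E" "l \<noteq> m" for l m
      using mixed[OF E(1) E(1)] that by blast
  qed (use F[OF one] G[OF one] jac \<open>c \<noteq> 0\<close> E pos F G nz diag in blast)+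
  define P where "P = (\<Sum>m\<in>E. const (a m) * (const v * F 1 - const u * G 1) ^ m)"
  have "f = F 1 + (\<Sum>m\<in>E. F m)" "g = G 1 + (\<Sum>m\<in>E. G m)"
    unfolding f g E_def by (intro sum.remove fin one)+
  then have "f = F 1 + const u * P" "g = G 1 + const v * P"
    unfolding P_def sum_distrib_left using FE GE by (metis (no_types, lifting) sum.cong)+
  then show ?thesis
    using elementary_map_generates[OF F[OF one] G[OF one] jac \<open>c \<noteq> 0\<close> refl P_def] by simp
qed

end
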